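(* Let $s\ge1$ be a fixed integer, let $(Y_t)$ be an $I(d)$ process with $d\in(-1/2,1/2)$, and consider the process with deterministic trend $$X_t=g_n(t)+Y_t,\qquad t=1,\dots,n,$$ where $g_n(t)=n^\beta g(t/n)$ with $\beta\ge0$, and $g:[0,1]\to\mathbb R$ is piecewise continuous and satisfies $$\int_0^1g(x)e^{\mathrm i2\pi jx}\,dx\ne0\quad\text{for some }j\in\{1,2,\dots,s\}.$$ Let $n=m\ell$ with $m=m(n)\to\infty$ and $\ell=\ell(n)\to\infty$ as $n\to\infty$. Then for all $\delta\le1/2$, the statistic $$Q_{n,m}(s,\delta)=m^{-2\delta}\sum_{j=1}^s\frac{I_n(\lambda_j)}{\frac1m\sum_{h=1}^mI_{n,h}(\lambda_j')}$$ computed from $X_1,\dots,X_n$ satisfies $Q_{n,m}(s,\delta)\to\infty$ in probability as $n\to\infty$.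
   Context: **$I(d)$ processes, $-1/2<d<1/2$.** $(Y_t)$ is an $I(d)$ process if $Y_t=\sum_{j=0}^\infty a_j\epsilon_{t-j}$, where $(\epsilon_j)_{j\in\mathbb Z}$ are i.i.d. with zero mean and finite fourth moment, $a_0=1$, $\sum_ja_j^2<\infty$, and - if $d=0$: $\sum_j|a_j|<\infty$; - if $0<d<1/2$: $a_j\sim c(d)j^{-1+d}$ as $j\to\infty$; - if $-1/2<d<0$: $\sum_ja_j=0$ and $a_j=c(d)j^{-1+d}(1+O(j^{-1}))$ as $j\to\infty$; where $c(d)>0$ is a constant. **Piecewise continuous** means that $[0,1]$ can be divided into finitely many sub-intervals such that $g$ is continuous on each open sub-interval, with finite limits at each endpoint. **Periodograms.** The sample $X_1,\dots,X_n$ is split into $m$ consecutive blocks of size $\ell$ ($n=m\ell$). For $j=1,\dots,s$ let $\lambda_j=2\pi j/n$, $\lambda_j'=2\pi j/\ell$, and $$I_n(\lambda_j)=\frac1{2\pi n}\Big|\sum_{t=1}^nX_te^{\mathrm it\lambda_j}\Big|^2,\qquad I_{n,h}(\lambda_j')=\frac1{2\pi\ell}\Big|\sum_{t=(h-1)\ell+1}^{h\ell}X_te^{\mathrm it\lambda_j'}\Big|^2,\quad h=1,\dots,m.$$ Convergence to $\infty$ in probability means $P(Q_{n,m}(s,\delta)>K)\to1$ for every $K>0$. *)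

theory Defs
  imports "HOL-Probability.Probability" "HOL-Library.Landau_Symbols"
begin

definition I_coefficients :: "real \<Rightarrow> (nat \<Rightarrow> real) \<Rightarrow> bool" where
  "I_coefficients d a \<longleftrightarrow>
     a 0 = 1 \<and> summable (\<lambda>j. (a j)\<^sup>2) \<and>
     (d = 0 \<longrightarrow> summable (\<lambda>j. \<bar>a j\<bar>)) \<and>
     (0 < d \<and> d < 1/2 \<longrightarrow>
        (\<exists>c>0. a \<sim>[at_top] (\<lambda>j. c * real j powr (-1 + d)))) \<and>
     (-1/2 < d \<and> d < 0 \<longrightarrow>
        a sums 0 \<and>
        (\<exists>c>0. \<exists>r \<in> O(\<lambda>j. 1 / real j).
           \<forall>\<^sub>F j in at_top. a j = c * real j powr (-1 + d) * (1 + r j)))"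

definition iid_noise :: "'a measure \<Rightarrow> (int \<Rightarrow> 'a \<Rightarrow> real) \<Rightarrow> bool" where
  "iid_noise M e \<longleftrightarrow>
     prob_space.indep_vars M (\<lambda>_. borel) e UNIV \<and>
     (\<forall>i j. distr M borel (e i) = distr M borel (e j)) \<and>
     (\<forall>j. integrable M (e j) \<and> integral\<^sup>L M (e j) = 0) \<and>
     (\<forall>j. integrable M (\<lambda>\<omega>. (e j \<omega>) ^ 4))"

text \<open>
  The moving-average series is read as an almost surely convergent one. For independent centred
  square-integrable innovations and square-summable coefficients it always converges, both almost
  surely and in mean square, with the same limit.
\<close>

definition I_process :: "'a measure \<Rightarrow> real \<Rightarrow> (int \<Rightarrow> 'a \<Rightarrow> real) \<Rightarrow> bool" where
  "I_process M d Y \<longleftrightarrow>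
     (\<exists>a e. I_coefficients d a \<and> iid_noise M e \<and>
        (\<forall>t. Y t \<in> borel_measurable M \<and>
             (AE \<omega> in M. (\<lambda>j. a j * e (t - int j) \<omega>) sums Y t \<omega>)))"

definition piecewise_continuous_01 :: "(real \<Rightarrow> real) \<Rightarrow> bool" where
  "piecewise_continuous_01 g \<longleftrightarrow>
     (\<exists>(N::nat) x. x 0 = 0 \<and> x N = 1 \<and>
        (\<forall>i<N. x i < x (Suc i) \<and>
               continuous_on {x i<..<x (Suc i)} g \<and>
               (\<exists>u. (g \<longlongrightarrow> u) (at_right (x i))) \<and>
               (\<exists>u. (g \<longlongrightarrow> u) (at_left (x (Suc i))))))"

definition trend :: "real \<Rightarrow> (real \<Rightarrow> real) \<Rightarrow> nat \<Rightarrow> nat \<Rightarrow> real" where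
  "trend \<beta> g n t = real n powr \<beta> * g (real t / real n)"

definition fourier_freq :: "nat \<Rightarrow> nat \<Rightarrow> real" where
  "fourier_freq n j = 2 * pi * real j / real n"

definition periodogram :: "(nat \<Rightarrow> real) \<Rightarrow> nat \<Rightarrow> real \<Rightarrow> real" where
  "periodogram x n w =
     1 / (2 * pi * real n) *
     (cmod (\<Sum>t=1..n. of_real (x t) * exp (\<i> * of_real (real t * w))))\<^sup>2"

definition block_periodogram :: "(nat \<Rightarrow> real) \<Rightarrow> nat \<Rightarrow> nat \<Rightarrow> real \<Rightarrow> real" where
  "block_periodogram x l h w =
     1 / (2 * pi * real l) *
     (cmod (\<Sum>t=(h - 1) * l + 1..h * l. of_real (x t) * exp (\<i> * of_real (real t * w))))\<^sup>2"

text \<open>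
  The statistic is a sum of quotients of nonnegative numbers and takes values in the extended
  nonnegative reals, so that a quotient with vanishing denominator is infinite if its numerator is
  positive, and \<open>0 / 0 = 0\<close>. The denominators can vanish with positive probability,
  for instance when the noise is discrete.
\<close>

definition Q_stat :: "(nat \<Rightarrow> real) \<Rightarrow> nat \<Rightarrow> nat \<Rightarrow> nat \<Rightarrow> real \<Rightarrow> ennreal" where
  "Q_stat x m l s \<delta> =
     ennreal (real m powr (-2 * \<delta>)) *
     (\<Sum>j=1..s.
        ennreal (periodogram x (m * l) (fourier_freq (m * l) j)) /
        ennreal (1 / real m * (\<Sum>h=1..m. block_periodogram x l h (fourier_freq l j))))"

definition tends_to_infinity_in_prob ::
    "'a measure \<Rightarrow> ('i \<Rightarrow> 'a \<Rightarrow> ennreal) \<Rightarrow> 'i filter \<Rightarrow> bool" where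
  "tends_to_infinity_in_prob M Q F \<longleftrightarrow>
     (\<forall>K::real. K > 0 \<longrightarrow> ((\<lambda>n. measure M {\<omega> \<in> space M. Q n \<omega> > ennreal K}) \<longlongrightarrow> 1) F)"

text \<open>
  Limit along an index set: only \<open>n\<close> factoring as block number times block length, with both
  factors large, are admissible sample sizes, so \<open>n\<close> cannot run through all naturals (it may not
  be prime, say).
\<close>

definition at_top_in :: "nat set \<Rightarrow> nat filter" where
  "at_top_in N = inf at_top (principal N)"

end

theory Submission
  imports Defs
begin

text \<open>
  The trend dominates the noise at the low frequencies of the full sample, whereas within short
  blocks it is nearly constant and is therefore almost invisible at the nonzero Fourier frequencies
  of a block. Fix \<open>j\<close> such that the \<open>j\<close>-th Fourier coefficient \<open>c\<close> of \<open>g\<close> does not vanish, and put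
  \<open>n = m * l\<close>.

  Numerator. The Fourier sum of the trend over the full sample is \<open>n powr (\<beta> + 1)\<close> times a Riemann
  sum that converges to \<open>c\<close> (\<open>trend_fourier_sum_tendsto\<close>). The Fourier sum of the noise is \<open>o(n)\<close> in
  mean square, so the numerator is of exact order \<open>n powr (2 * \<beta> + 1)\<close>.

  Denominator. The Fourier exponentials sum to \<open>0\<close> over each block, so subtracting from \<open>g\<close> a constant
  on each block changes nothing, and the Cauchy-Schwarz inequality bounds the contribution of the
  trend to the average block periodogram by \<open>l * n powr (2 * \<beta>)\<close> times the mean square oscillation of
  \<open>g\<close> over the blocks (\<open>trend_block_sum_bound\<close>), which tends to \<open>0\<close> (\<open>block_oscillation_tendsto\<close>). The
  noise contributes \<open>o(l)\<close> in mean. As \<open>\<beta> \<ge> 0\<close>, the denominator is \<open>o(l * n powr (2 * \<beta>))\<close> in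
  probability.

  The quotient thus exceeds every multiple of \<open>n / l = m\<close> with probability tending to \<open>1\<close>, and the
  factor \<open>m powr (-2 * \<delta>)\<close> is at least \<open>1 / m\<close> because \<open>\<delta> \<le> 1/2\<close>.

  The required bound on the noise, that Fourier sums of length \<open>L\<close> have second moment \<open>o(L\<^sup>2)\<close>
  uniformly in position and frequency (\<open>moving_average_fourier_sum\<close>), holds for every square-summable
  moving average of white noise. No case distinction on the memory parameter is needed.
\<close>

section \<open>Limits along a set of sample sizes\<close>

text \<open>
  Limits along an infinite set \<open>N\<close> of sample sizes are limits along a sequence. Leaving out the
  sample size \<open>0\<close> makes all block numbers and block lengths along the sequence positive.
\<close>

lemma at_top_in_enumeration:
  assumes "infinite N"
  obtains u :: "nat \<Rightarrow> nat" where "\<And>k. u k \<in> N" "\<And>k. u k > 0"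
    "at_top_in N = filtermap u sequentially"
proof -
  have inf: "infinite (N - {0})" using assms by simp
  define u where "u = enumerate (N - {0})"
  have mono: "strict_mono u" unfolding u_def using inf by (rule strict_mono_enumerate)
  have mem: "u k \<in> N - {0}" for k unfolding u_def using inf by (rule enumerate_in_set)
  have ex: "\<exists>k. u k = n" if "n \<in> N - {0}" for n
    unfolding u_def using inf that by (metis enumerate_Ex)
  have ev: "eventually P (at_top_in N) \<longleftrightarrow> eventually P (filtermap u sequentially)" for P
  proof -
    have "eventually P (at_top_in N) \<longleftrightarrow> (\<exists>b. \<forall>n\<ge>b. n \<in> N \<longrightarrow> P n)"
      by (simp add: at_top_in_def eventually_inf_principal eventually_at_top_linorder)
    also have "\<dots> \<longleftrightarrow> (\<exists>K. \<forall>k\<ge>K. P (u k))"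
    proof safe
      fix b assume "\<forall>n\<ge>b. n \<in> N \<longrightarrow> P n"
      moreover have "u k \<ge> b" if "k \<ge> b" for k
        using seq_suble[OF mono, of k] that by linarith
      ultimately show "\<exists>K. \<forall>k\<ge>K. P (u k)" using mem by blast
    next
      fix K assume K: "\<forall>k\<ge>K. P (u k)"
      have "P n" if n: "n \<ge> u K" "n \<in> N" for n
      proof -
        have "n \<in> N - {0}" using n mem[of K] by auto
        then obtain k where "u k = n" using ex by blast
        with n K show ?thesis using strict_mono_less_eq[OF mono] by blast
      qed
      then show "\<exists>b. \<forall>n\<ge>b. n \<in> N \<longrightarrow> P n" by blast
    qed
    finally show ?thesis
      by (simp add: eventually_filtermap eventually_at_top_linorder)
  qed
  show ?thesis
    by (rule that) (use mem ev in \<open>auto simp: filter_eq_iff\<close>)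
qed

section \<open>Sums as integrals of step functions\<close>

text \<open>
  All that the argument uses of piecewise continuity: boundedness on the closed unit interval, and
  continuity off a finite set \<open>S\<close>. The division points, \<open>0\<close> and \<open>1\<close> among them, go into \<open>S\<close>, since
  the values of \<open>g\<close> there are unconstrained.
\<close>

lemma piecewise_continuous_01_imp:
  assumes "piecewise_continuous_01 g"
  obtains S B where "finite S" "\<And>x. 0 \<le> x \<Longrightarrow> x \<le> 1 \<Longrightarrow> x \<notin> S \<Longrightarrow> isCont g x"
    "\<And>x. 0 \<le> x \<Longrightarrow> x \<le> 1 \<Longrightarrow> \<bar>g x\<bar> \<le> B"
proof -
  obtain N :: nat and x where x0: "x 0 = 0" and xN: "x N = 1"
    and lt: "\<And>i. i < N \<Longrightarrow> x i < x (Suc i)"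
    and cont: "\<And>i. i < N \<Longrightarrow> continuous_on {x i<..<x (Suc i)} g"
    and lr: "\<And>i. i < N \<Longrightarrow> \<exists>u. (g \<longlongrightarrow> u) (at_right (x i))"
    and ll: "\<And>i. i < N \<Longrightarrow> \<exists>u. (g \<longlongrightarrow> u) (at_left (x (Suc i)))"
    using assms unfolding piecewise_continuous_01_def by blast
  have isc: "isCont g y" if "i < N" "x i < y" "y < x (Suc i)" for i y
    using cont[OF that(1)] that by (simp add: continuous_on_eq_continuous_at)
  have bdd: "\<exists>B. \<forall>y\<in>{x i..x (Suc i)}. \<bar>g y\<bar> \<le> B" if i: "i < N" for i
  proof -
    obtain u v where u: "(g \<longlongrightarrow> u) (at_right (x i))" and v: "(g \<longlongrightarrow> v) (at_left (x (Suc i)))"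
      using lr ll i by blast
    \<comment> \<open>The values at the endpoints are replaced by the one-sided limits.\<close>
    define f where "f y = (if y = x i then u else if y = x (Suc i) then v else g y)" for y
    have "continuous_on {x i..x (Suc i)} f"
    proof (rule continuous_on_IccI)
      have "eventually (\<lambda>y. y \<in> {x i<..<x (Suc i)}) (at_right (x i))"
        using lt[OF i] by (simp add: eventually_at_right_less eventually_at_right[OF lt[OF i]]) auto
      then have "eventually (\<lambda>y. g y = f y) (at_right (x i))"
        by eventually_elim (auto simp: f_def)
      then show "(f \<longlongrightarrow> f (x i)) (at_right (x i))"
        using u by (subst filterlim_cong[OF refl refl, symmetric]) (auto simp: f_def)
    next
      have "eventually (\<lambda>y. y \<in> {x i<..<x (Suc i)}) (at_left (x (Suc i)))"
        using lt[OF i] by (simp add: eventually_at_left[OF lt[OF i]]) auto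
      then have "eventually (\<lambda>y. g y = f y) (at_left (x (Suc i)))"
        by eventually_elim (auto simp: f_def)
      then show "(f \<longlongrightarrow> f (x (Suc i))) (at_left (x (Suc i)))"
        using v lt[OF i] by (subst filterlim_cong[OF refl refl, symmetric]) (auto simp: f_def)
    next
      fix y assume y: "x i < y" "y < x (Suc i)"
      have "eventually (\<lambda>z. z \<in> {x i<..<x (Suc i)}) (at y)"
        using y eventually_at_in_open'[of "{x i<..<x (Suc i)}" y] by simp
      then have "eventually (\<lambda>z. g z = f z) (at y)"
        by eventually_elim (auto simp: f_def)
      moreover have "(g \<longlongrightarrow> g y) (at y)" using isc[OF i y] by (simp add: isCont_def)
      ultimately show "f \<midarrow>y\<rightarrow> f y"
        using y by (subst filterlim_cong[OF refl refl, symmetric]) (auto simp: f_def)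
    qed (use lt[OF i] in simp)
    then have "compact (f ` {x i..x (Suc i)})" by (intro compact_continuous_image) auto
    then obtain B where "\<forall>z\<in>f ` {x i..x (Suc i)}. norm z \<le> B"
      using compact_imp_bounded bounded_iff by metis
    then have B: "\<bar>f y\<bar> \<le> B" if "y \<in> {x i..x (Suc i)}" for y using that by auto
    have "\<bar>g y\<bar> \<le> max B (max \<bar>g (x i)\<bar> \<bar>g (x (Suc i))\<bar>)" if "y \<in> {x i..x (Suc i)}" for y
      using B[OF that] by (auto simp: f_def split: if_splits)
    then show ?thesis by blast
  qed
  then obtain C where C: "\<And>i y. i < N \<Longrightarrow> y \<in> {x i..x (Suc i)} \<Longrightarrow> \<bar>g y\<bar> \<le> C i" by metis
  have cover: "\<exists>i<k. y \<in> {x i..x (Suc i)}" if "k \<le> N" "k > 0" "x 0 \<le> y" "y \<le> x k" for k y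
    using that
  proof (induction k)
    case (Suc k)
    show ?case
    proof (cases "k > 0 \<and> y \<le> x k")
      case True
      with Suc obtain i where "i < k" "y \<in> {x i..x (Suc i)}" by auto
      then show ?thesis using less_SucI by blast
    next
      case False
      then have "x k \<le> y" using Suc.prems by (cases "k = 0") auto
      then show ?thesis using Suc.prems by auto
    qed
  qed simp
  have N: "N > 0" using x0 xN by (metis gr0I zero_neq_one)
  define S where "S = x ` {..N}"
  define B where "B = (\<Sum>i<N. \<bar>C i\<bar>)"
  show ?thesis
  proof (rule that[of S B])
    show "finite S" by (simp add: S_def)
  next
    fix y :: real assume y: "0 \<le> y" "y \<le> 1" "y \<notin> S"
    obtain i where i: "i < N" "y \<in> {x i..x (Suc i)}"
      using cover[of N y] N x0 xN y by auto
    have "x i \<in> S" "x (Suc i) \<in> S" using i by (auto simp: S_def)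
    with i y have "x i < y" "y < x (Suc i)" by (auto simp: less_le)
    then show "isCont g y" using isc i by blast
  next
    fix y :: real assume y: "0 \<le> y" "y \<le> 1"
    obtain i where i: "i < N" "y \<in> {x i..x (Suc i)}"
      using cover[of N y] N x0 xN y by auto
    have "\<bar>g y\<bar> \<le> \<bar>C i\<bar>" using C[OF i] by linarith
    also have "\<dots> \<le> B" unfolding B_def using i by (intro member_le_sum) auto
    finally show "\<bar>g y\<bar> \<le> B" .
  qed
qed

text \<open>
  A normalized sum is the integral of a step function. This turns the limits of sums below into
  applications of dominated convergence, for functions that need only be continuous almost
  everywhere.
\<close>

lemma has_integral_step:
  fixes h :: "nat \<Rightarrow> 'b::euclidean_space"
  assumes n: "n > 0"
  shows "((\<lambda>x. h (nat \<lceil>real n * x\<rceil>)) has_integral (1 / real n) *\<^sub>R (\<Sum>t=1..k. h t)) {0..real k / real n}"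
proof (induction k)
  case 0
  show ?case using has_integral_refl(1)[of _ "0::real"] by (simp add: cbox_interval)
next
  case (Suc k)
  let ?a = "real k / real n" and ?b = "real (Suc k) / real n"
  have ab: "?b - ?a = 1 / real n" by (simp add: add_divide_distrib)
  have "((\<lambda>x. h (Suc k)) has_integral measure lborel (cbox ?a ?b) *\<^sub>R h (Suc k)) (cbox ?a ?b)"
    by (rule has_integral_const)
  moreover have "measure lborel (cbox ?a ?b) = 1 / real n"
    using n ab by (simp add: divide_right_mono)
  ultimately have c: "((\<lambda>x. h (Suc k)) has_integral (1 / real n) *\<^sub>R h (Suc k)) (cbox ?a ?b)" by simp
  have "((\<lambda>x. h (nat \<lceil>real n * x\<rceil>)) has_integral (1 / real n) *\<^sub>R h (Suc k)) (cbox ?a ?b)"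
  proof (rule has_integral_spike_interior[OF c])
    fix x assume "x \<in> box ?a ?b"
    then have "real k < real n * x" "real n * x < real (Suc k)"
      using n by (auto simp: box_real field_simps)
    then have "\<lceil>real n * x\<rceil> = int (Suc k)" by (intro ceiling_unique) auto
    then show "h (nat \<lceil>real n * x\<rceil>) = h (Suc k)" by (simp only: nat_int)
  qed
  then have "((\<lambda>x. h (nat \<lceil>real n * x\<rceil>)) has_integral
     (1 / real n) *\<^sub>R (\<Sum>t=1..k. h t) + (1 / real n) *\<^sub>R h (Suc k)) {0..?b}"
    using Suc.IH n by (intro has_integral_combine[of 0 ?a ?b]) (auto simp: cbox_interval divide_right_mono)
  then show ?case by (simp add: scaleR_right_distrib)
qed

text \<open>
  The summands may depend on \<open>k\<close> arbitrarily, so that the lemma covers both Riemann sums and the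
  mean oscillation over blocks.
\<close>

lemma tendsto_mean_step:
  fixes h :: "nat \<Rightarrow> nat \<Rightarrow> 'b::euclidean_space" and F :: "real \<Rightarrow> 'b"
  assumes n: "\<And>k. n k > 0"
    and bound: "\<And>k t. t \<le> n k \<Longrightarrow> norm (h k t) \<le> B"
    and S: "finite S"
    and lim: "\<And>x. 0 \<le> x \<Longrightarrow> x \<le> 1 \<Longrightarrow> x \<notin> S \<Longrightarrow>
                (\<lambda>k. h k (nat \<lceil>real (n k) * x\<rceil>)) \<longlonglongrightarrow> F x"
  shows "(\<lambda>k. (1 / real (n k)) *\<^sub>R (\<Sum>t=1..n k. h k t)) \<longlonglongrightarrow> integral {0..1} F"
proof -
  let ?f = "\<lambda>k x. h k (nat \<lceil>real (n k) * x\<rceil>)" and ?T = "{0..1} - S"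
  have hi: "(?f k has_integral (1 / real (n k)) *\<^sub>R (\<Sum>t=1..n k. h k t)) {0..1}" for k
    using has_integral_step[OF n, of "h k" k "n k"] n[of k] by simp
  have neg: "negligible {x \<in> {0..1} - ?T. P x}" "negligible {x \<in> ?T - {0..1}. P x}" for P
    by (rule negligible_finite, rule finite_subset[OF _ S], auto)+
  have T: "(?f k has_integral (1 / real (n k)) *\<^sub>R (\<Sum>t=1..n k. h k t)) ?T" for k
    using has_integral_spike_set_eq[OF neg] hi[of k] by blast
  have "(\<lambda>k. integral ?T (?f k)) \<longlonglongrightarrow> integral ?T F"
  proof (rule dominated_convergence(2))
    show "?f k integrable_on ?T" for k using T by blast
    have "(\<lambda>x. B) integrable_on {0..1::real}" by (rule integrable_const_ivl)
    then show "(\<lambda>x. B) integrable_on ?T"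
      by (rule integrable_spike_set) (rule neg)+
    show "norm (?f k x) \<le> B" if "x \<in> ?T" for k x
    proof (rule bound)
      have "real (n k) * x \<le> real (n k)" using that by (simp add: mult_left_le)
      then show "nat \<lceil>real (n k) * x\<rceil> \<le> n k" by (simp add: nat_le_iff ceiling_le_iff)
    qed
    show "(\<lambda>k. ?f k x) \<longlonglongrightarrow> F x" if "x \<in> ?T" for x
      using lim that by auto
  qed
  moreover have "integral ?T (?f k) = (1 / real (n k)) *\<^sub>R (\<Sum>t=1..n k. h k t)" for k
    using T by (rule integral_unique)
  moreover have "integral ?T F = integral {0..1} F"
    by (rule integral_spike_set) (rule neg)+
  ultimately show ?thesis by simp
qed

lemma ceiling_grid_tendsto:
  assumes "filterlim n at_top sequentially" "0 \<le> x"
  shows "(\<lambda>k. real (nat \<lceil>real (n k) * x\<rceil>) / real (n k)) \<longlonglongrightarrow> x"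
proof (rule tendsto_sandwich)
  have pos: "eventually (\<lambda>k. n k > 0) sequentially"
    using filterlim_at_top[THEN iffD1, rule_format, OF assms(1), of 1] by (simp add: Suc_le_eq)
  have cl: "real (nat \<lceil>real (n k) * x\<rceil>) = of_int \<lceil>real (n k) * x\<rceil>" for k
    using assms(2) by simp
  show "eventually (\<lambda>k. x \<le> real (nat \<lceil>real (n k) * x\<rceil>) / real (n k)) sequentially"
    using pos
  proof eventually_elim
    case (elim k)
    then show ?case using le_of_int_ceiling[of "real (n k) * x"] unfolding cl by (simp add: field_simps)
  qed
  show "eventually (\<lambda>k. real (nat \<lceil>real (n k) * x\<rceil>) / real (n k) \<le> x + 1 / real (n k)) sequentially"
    using pos
  proof eventually_elim
    case (elim k)
    then show ?case using of_int_ceiling_le_add_one[of "real (n k) * x"] unfolding cl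
      by (simp add: field_simps)
  qed
  have "(\<lambda>k. 1 / real (n k)) \<longlonglongrightarrow> 0"
    using filterlim_compose[OF lim_1_over_n assms(1)] by simp
  from tendsto_add[OF tendsto_const this]
  show "(\<lambda>k. x + 1 / real (n k)) \<longlonglongrightarrow> x" by simp
qed simp

lemma riemann_sum_tendsto:
  fixes f :: "real \<Rightarrow> 'b::euclidean_space"
  assumes n: "\<And>k. n k > 0" "filterlim n at_top sequentially"
    and S: "finite S" "\<And>x. 0 \<le> x \<Longrightarrow> x \<le> 1 \<Longrightarrow> x \<notin> S \<Longrightarrow> isCont f x"
    and B: "\<And>x. 0 \<le> x \<Longrightarrow> x \<le> 1 \<Longrightarrow> norm (f x) \<le> B"
  shows "(\<lambda>k. (1 / real (n k)) *\<^sub>R (\<Sum>t=1..n k. f (real t / real (n k)))) \<longlonglongrightarrow> integral {0..1} f"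
proof (rule tendsto_mean_step[OF n(1) _ S(1)])
  show "norm (f (real t / real (n k))) \<le> B" if "t \<le> n k" for k t
    using that n(1)[of k] by (intro B) auto
  show "(\<lambda>k. f (real (nat \<lceil>real (n k) * x\<rceil>) / real (n k))) \<longlonglongrightarrow> f x"
    if "0 \<le> x" "x \<le> 1" "x \<notin> S" for x
    using ceiling_grid_tendsto[OF n(2) that(1)] S(2)[OF that] by (rule isCont_tendsto_compose[rotated])
qed

section \<open>Sums over blocks\<close>

lemma sum_blocks:
  fixes f :: "nat \<Rightarrow> 'b::comm_monoid_add"
  shows "(\<Sum>h=1..m. \<Sum>t=(h - 1) * l + 1..h * l. f t) = (\<Sum>t=1..m * l. f t)"
proof (induction m)
  case (Suc m)
  have "(\<Sum>t=1..Suc m * l. f t) = (\<Sum>t=1..m * l. f t) + (\<Sum>t=m * l + 1..m * l + l. f t)"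
    using sum.ub_add_nat[of 1 "m * l" f l] by (simp add: add.commute)
  then show ?case using Suc by (simp add: add.commute)
qed simp

lemma ceiling_block:
  assumes "l > 0" "h \<ge> 1" "t \<in> {(h - 1) * l + 1..h * l}"
  shows "nat \<lceil>real t / real l\<rceil> = h"
proof -
  have "real ((h - 1) * l) < real t" "real t \<le> real (h * l)" using assms(3) by (auto simp flip: of_nat_mult)
  then have "\<lceil>real t / real l\<rceil> = int h"
    using assms(1,2) by (intro ceiling_unique) (auto simp: field_simps of_nat_diff)
  then show ?thesis by simp
qed

text \<open>
  On average, \<open>g\<close> differs little in mean square from its value at the right end point of the
  block. No separate treatment of the blocks that contain a discontinuity is needed: the normalized
  sum is the integral of a bounded step function that tends to \<open>0\<close> wherever \<open>g\<close> is continuous.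
\<close>

lemma block_oscillation_tendsto:
  fixes g :: "real \<Rightarrow> real"
  assumes m: "\<And>k. m k > 0" "filterlim m at_top sequentially" and l: "\<And>k. l k > 0"
    and S: "finite S" "\<And>x. 0 \<le> x \<Longrightarrow> x \<le> 1 \<Longrightarrow> x \<notin> S \<Longrightarrow> isCont g x"
    and B: "\<And>x. 0 \<le> x \<Longrightarrow> x \<le> 1 \<Longrightarrow> \<bar>g x\<bar> \<le> B"
  shows "(\<lambda>k. 1 / real (m k * l k) * (\<Sum>h=1..m k. \<Sum>t=(h - 1) * l k + 1..h * l k.
            (g (real t / real (m k * l k)) - g (real h / real (m k)))\<^sup>2)) \<longlonglongrightarrow> 0"
proof -
  define n where "n k = m k * l k" for k
  have n: "n k > 0" for k using m(1) l by (simp add: n_def)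
  have nm: "n k \<ge> m k" for k using l[of k] by (simp add: n_def)
  have n_inf: "filterlim n at_top sequentially"
    by (rule filterlim_at_top_mono[OF m(2)]) (simp add: nm)
  \<comment> \<open>\<open>q k t\<close> is the right end point, rescaled to the unit interval, of the block containing \<open>t\<close>.\<close>
  define q where "q k t = real (nat \<lceil>real t / real (l k)\<rceil>) / real (m k)" for k t
  define w where "w k t = (g (real t / real (n k)) - g (q k t))\<^sup>2" for k t
  have q_bounds: "real t / real (n k) \<le> q k t" "q k t \<le> real t / real (n k) + 1 / real (m k)" for k t
  proof -
    have "real t / real (l k) \<le> of_int \<lceil>real t / real (l k)\<rceil>"
      "of_int \<lceil>real t / real (l k)\<rceil> \<le> real t / real (l k) + 1" by auto
    moreover have "q k t = of_int \<lceil>real t / real (l k)\<rceil> / real (m k)"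
      unfolding q_def by simp
    ultimately have "real t / real (l k) / real (m k) \<le> q k t"
      "q k t \<le> (real t / real (l k) + 1) / real (m k)"
      by (simp_all only: divide_right_mono of_nat_0_le_iff)
    then show "real t / real (n k) \<le> q k t" "q k t \<le> real t / real (n k) + 1 / real (m k)"
      unfolding n_def by (simp_all add: add_divide_distrib mult.commute del: of_int_ceiling)
  qed
  have q01: "0 \<le> q k t" "t \<le> n k \<Longrightarrow> q k t \<le> 1" for k t
  proof -
    show "0 \<le> q k t" unfolding q_def by (intro divide_nonneg_nonneg of_nat_0_le_iff)
    assume "t \<le> n k"
    then have "real t \<le> real (m k) * real (l k)" unfolding n_def by (metis of_nat_le_iff of_nat_mult)
    then have "real t / real (l k) \<le> real (m k)" using l[of k] by (simp add: field_simps)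
    then have "nat \<lceil>real t / real (l k)\<rceil> \<le> m k" by (simp add: nat_le_iff ceiling_le_iff)
    then show "q k t \<le> 1"
      unfolding q_def using m(1)[of k] by (simp only: divide_le_eq_1_pos of_nat_0_less_iff of_nat_le_iff)
  qed
  have "(\<lambda>k. (1 / real (n k)) *\<^sub>R (\<Sum>t=1..n k. w k t)) \<longlonglongrightarrow> integral {0..1} (\<lambda>x::real. 0)"
  proof (rule tendsto_mean_step[OF n _ S(1)])
    fix k t assume t: "t \<le> n k"
    have "\<bar>g (real t / real (n k))\<bar> \<le> B" using t n[of k] by (intro B) auto
    moreover have "\<bar>g (q k t)\<bar> \<le> B" using q01 t by (intro B) auto
    ultimately have "\<bar>g (real t / real (n k)) - g (q k t)\<bar> \<le> 2 * B" by linarith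
    then have "\<bar>g (real t / real (n k)) - g (q k t)\<bar>\<^sup>2 \<le> (2 * B)\<^sup>2" by (rule power_mono) simp
    then show "norm (w k t) \<le> (2 * B)\<^sup>2" by (simp add: w_def)
  next
    fix x :: real assume x: "0 \<le> x" "x \<le> 1" "x \<notin> S"
    define T where "T k = nat \<lceil>real (n k) * x\<rceil>" for k
    have T: "(\<lambda>k. real (T k) / real (n k)) \<longlonglongrightarrow> x"
      unfolding T_def by (rule ceiling_grid_tendsto[OF n_inf x(1)])
    have "(\<lambda>k. 1 / real (m k)) \<longlonglongrightarrow> 0"
      using filterlim_compose[OF lim_1_over_n m(2)] by simp
    with T have T': "(\<lambda>k. real (T k) / real (n k) + 1 / real (m k)) \<longlonglongrightarrow> x"
      using tendsto_add by fastforce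
    have Q: "(\<lambda>k. q k (T k)) \<longlonglongrightarrow> x"
      by (rule tendsto_sandwich[OF _ _ T T']) (simp_all add: q_bounds)
    have "(\<lambda>k. (g (real (T k) / real (n k)) - g (q k (T k)))\<^sup>2) \<longlonglongrightarrow> (g x - g x)\<^sup>2"
      by (intro tendsto_power tendsto_diff isCont_tendsto_compose[OF S(2)[OF x]] T Q)
    then show "(\<lambda>k. w k (nat \<lceil>real (n k) * x\<rceil>)) \<longlonglongrightarrow> 0"
      by (simp add: w_def T_def)
  qed
  moreover have "(\<Sum>h=1..m k. \<Sum>t=(h - 1) * l k + 1..h * l k.
      (g (real t / real (m k * l k)) - g (real h / real (m k)))\<^sup>2) = (\<Sum>t=1..n k. w k t)" for k
  proof -
    have "(\<Sum>t=1..n k. w k t) = (\<Sum>h=1..m k. \<Sum>t=(h - 1) * l k + 1..h * l k. w k t)"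
      unfolding n_def by (rule sum_blocks[symmetric])
    also have "\<dots> = (\<Sum>h=1..m k. \<Sum>t=(h - 1) * l k + 1..h * l k.
      (g (real t / real (m k * l k)) - g (real h / real (m k)))\<^sup>2)"
    proof (intro sum.cong refl)
      fix h t assume "h \<in> {1..m k}" and t: "t \<in> {(h - 1) * l k + 1..h * l k}"
      then have "nat \<lceil>real t / real (l k)\<rceil> = h" by (intro ceiling_block[OF l]) auto
      then show "w k t = (g (real t / real (m k * l k)) - g (real h / real (m k)))\<^sup>2"
        by (simp only: w_def q_def n_def)
    qed
    finally show ?thesis by simp
  qed
  ultimately show ?thesis by (simp add: n_def)
qed

lemma sum_exp_block_eq_0:
  assumes "0 < j" "j < l"
  shows "(\<Sum>t=a + 1..a + l. exp (\<i> * of_real (real t * fourier_freq l j))) = 0"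
proof -
  define w where "w = exp (\<i> * of_real (fourier_freq l j))"
  have e: "exp (\<i> * of_real (real t * fourier_freq l j)) = w ^ t" for t
    unfolding w_def by (simp add: exp_of_nat_mult[symmetric] mult_ac)
  have w: "w = exp (2 * of_real pi * \<i> * of_nat j / of_nat l)"
    unfolding w_def fourier_freq_def by (simp add: mult_ac)
  have "w \<noteq> 1"
    unfolding w using complex_root_unity_eq_1[of l j] assms by (auto dest: nat_dvd_not_less)
  moreover have "w ^ l = 1"
    unfolding w using assms complex_root_unity[of l j] by simp
  ultimately have "(\<Sum>i<l. w ^ i) = 0" by (simp add: geometric_sum)
  then have "(\<Sum>i<l. w ^ (a + 1) * w ^ i) = 0" by (simp flip: sum_distrib_left)
  also have "(\<Sum>i<l. w ^ (a + 1) * w ^ i) = (\<Sum>t=a + 1..a + l. w ^ t)"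
    by (rule sum.reindex_bij_witness[of _ "\<lambda>t. t - (a + 1)" "\<lambda>i. i + (a + 1)"])
      (auto simp: power_add mult_ac)
  finally show ?thesis by (simp only: e)
qed

text \<open>
  Since the exponentials sum to \<open>0\<close> over a block, the trend may be replaced within the block by its
  deviation from the value at the right end point.
\<close>

lemma trend_block_sum_bound:
  assumes j: "0 < j" "j < l" and m: "m > 0"
  shows "(\<Sum>h=1..m. (cmod (\<Sum>t=(h - 1) * l + 1..h * l.
            of_real (trend \<beta> g (m * l) t) * exp (\<i> * of_real (real t * fourier_freq l j))))\<^sup>2)
    \<le> (real (m * l) powr \<beta>)\<^sup>2 * real l * (\<Sum>h=1..m. \<Sum>t=(h - 1) * l + 1..h * l.
            (g (real t / real (m * l)) - g (real h / real m))\<^sup>2)"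
  unfolding sum_distrib_left[where A = "{1..m}"]
proof (rule sum_mono)
  fix h assume h: "h \<in> {1..m}"
  let ?T = "{(h - 1) * l + 1..h * l}" and ?E = "\<lambda>t. exp (\<i> * of_real (real t * fourier_freq l j))"
    and ?b = "real (m * l) powr \<beta>" and ?d = "\<lambda>t. g (real t / real (m * l)) - g (real h / real m)"
  have hl: "h * l = (h - 1) * l + l" using h by (cases h) auto
  have card: "card ?T = l" by (simp add: hl)
  have zero: "(\<Sum>t\<in>?T. ?E t) = 0"
    unfolding hl using j by (rule sum_exp_block_eq_0)
  have "(\<Sum>t\<in>?T. of_real (trend \<beta> g (m * l) t) * ?E t)
      = (\<Sum>t\<in>?T. of_real (?b * ?d t) * ?E t) + of_real (?b * g (real h / real m)) * (\<Sum>t\<in>?T. ?E t)"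
    unfolding sum_distrib_left sum.distrib[symmetric]
    by (intro sum.cong refl) (simp add: trend_def algebra_simps)
  also have "\<dots> = (\<Sum>t\<in>?T. of_real (?b * ?d t) * ?E t)" by (simp only: zero mult_zero_right add_0_right)
  finally have "cmod (\<Sum>t\<in>?T. of_real (trend \<beta> g (m * l) t) * ?E t) \<le> (\<Sum>t\<in>?T. cmod (of_real (?b * ?d t) * ?E t))"
    by (simp only: norm_sum)
  also have "\<dots> = (\<Sum>t\<in>?T. \<bar>?b * ?d t\<bar>)"
    by (simp add: norm_mult del: of_real_mult of_nat_mult)
  finally have "(cmod (\<Sum>t\<in>?T. of_real (trend \<beta> g (m * l) t) * ?E t))\<^sup>2 \<le> (\<Sum>t\<in>?T. \<bar>?b * ?d t\<bar>)\<^sup>2"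
    by (rule power_mono) simp
  also have "\<dots> \<le> (\<Sum>t\<in>?T. \<bar>?b * ?d t\<bar>\<^sup>2) * card ?T" by (rule sum_squared_le_sum_of_squares)
  also have "\<dots> = ?b\<^sup>2 * real l * (\<Sum>t\<in>?T. (?d t)\<^sup>2)"
    unfolding card by (simp add: power_mult_distrib sum_distrib_left mult_ac del: of_nat_mult)
  finally show "(cmod (\<Sum>t\<in>?T. of_real (trend \<beta> g (m * l) t) * ?E t))\<^sup>2 \<le> \<dots>" .
qed

section \<open>Fourier sums of the trend over the full sample\<close>

lemma trend_fourier_sum_tendsto:
  fixes g :: "real \<Rightarrow> real"
  assumes n: "\<And>k. n k > 0" "filterlim n at_top sequentially"
    and S: "finite S" "\<And>x. 0 \<le> x \<Longrightarrow> x \<le> 1 \<Longrightarrow> x \<notin> S \<Longrightarrow> isCont g x"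
    and B: "\<And>x. 0 \<le> x \<Longrightarrow> x \<le> 1 \<Longrightarrow> \<bar>g x\<bar> \<le> B"
  shows "(\<lambda>k. cmod (\<Sum>t=1..n k. of_real (trend \<beta> g (n k) t) * exp (\<i> * of_real (real t * fourier_freq (n k) j)))
            / (real (n k) * real (n k) powr \<beta>))
     \<longlonglongrightarrow> cmod (integral {0..1} (\<lambda>x. of_real (g x) * exp (\<i> * of_real (2 * pi * real j * x))))"
proof -
  let ?f = "\<lambda>x. of_real (g x) * exp (\<i> * of_real (2 * pi * real j * x)) :: complex"
  have "(\<lambda>k. (1 / real (n k)) *\<^sub>R (\<Sum>t=1..n k. ?f (real t / real (n k)))) \<longlonglongrightarrow> integral {0..1} ?f"
    by (rule riemann_sum_tendsto[OF n S(1)])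
       (use S(2) B in \<open>auto simp: norm_mult intro!: continuous_intros\<close>)
  then have "(\<lambda>k. cmod ((1 / real (n k)) *\<^sub>R (\<Sum>t=1..n k. ?f (real t / real (n k))))) \<longlonglongrightarrow> cmod (integral {0..1} ?f)"
    by (rule tendsto_norm)
  moreover have "cmod ((1 / real (n k)) *\<^sub>R (\<Sum>t=1..n k. ?f (real t / real (n k))))
     = cmod (\<Sum>t=1..n k. of_real (trend \<beta> g (n k) t) * exp (\<i> * of_real (real t * fourier_freq (n k) j)))
            / (real (n k) * real (n k) powr \<beta>)" for k
  proof -
    have "(\<Sum>t=1..n k. of_real (trend \<beta> g (n k) t) * exp (\<i> * of_real (real t * fourier_freq (n k) j)))
      = of_real (real (n k) powr \<beta>) * (\<Sum>t=1..n k. ?f (real t / real (n k)))"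
      unfolding sum_distrib_left trend_def fourier_freq_def
      by (intro sum.cong refl) (simp add: mult_ac)
    then show ?thesis using n(1)[of k] by (simp add: norm_mult)
  qed
  ultimately show ?thesis by simp
qed

section \<open>Fourier sums of moving averages of white noise\<close>

text \<open>
  White noise of variance \<open>v\<close>: random variables with \<open>E (e i * e j) = v\<close> if \<open>i = j\<close> and \<open>0\<close> otherwise.
  Only products enter, so the mean need not vanish; no probability space is required either.
\<close>

definition white_noise :: "'a measure \<Rightarrow> real \<Rightarrow> (int \<Rightarrow> 'a \<Rightarrow> real) \<Rightarrow> bool" where
  "white_noise M v e \<longleftrightarrow>
     (\<forall>i. e i \<in> borel_measurable M) \<and>
     (\<forall>i j. integrable M (\<lambda>\<omega>. e i \<omega> * e j \<omega>) \<and>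
            (\<integral>\<omega>. e i \<omega> * e j \<omega> \<partial>M) = (if i = j then v else 0))"

lemma iid_noise_imp_white_noise:
  assumes M: "prob_space M" and "iid_noise M e"
  obtains v where "white_noise M v e"
proof -
  interpret prob_space M by (rule M)
  have ind: "indep_vars (\<lambda>_. borel) e UNIV"
    and dist: "\<And>i j. distr M borel (e i) = distr M borel (e j)"
    and int1: "\<And>j. integrable M (e j)" and zero: "\<And>j. expectation (e j) = 0"
    and int4: "\<And>j. integrable M (\<lambda>\<omega>. (e j \<omega>) ^ 4)"
    using assms(2) unfolding iid_noise_def by blast+
  have meas[measurable]: "e i \<in> borel_measurable M" for i using int1 by (rule borel_measurable_integrable)
  have int2: "integrable M (\<lambda>\<omega>. e i \<omega> * e i \<omega>)" for i
  proof (rule Bochner_Integration.integrable_bound)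
    show "integrable M (\<lambda>\<omega>. 1 + (e i \<omega>) ^ 4)" using int4 by simp
    have "x * x \<le> 1 + x ^ 4" for x :: real
    proof -
      have "0 \<le> (x\<^sup>2 - 1)\<^sup>2 + x\<^sup>2 * x\<^sup>2 + 1" by (intro add_nonneg_nonneg) auto
      then show ?thesis by (simp add: power2_eq_square power4_eq_xxxx algebra_simps)
    qed
    then show "AE \<omega> in M. norm (e i \<omega> * e i \<omega>) \<le> norm (1 + (e i \<omega>) ^ 4)"
      by (intro AE_I2) simp
  qed simp
  have var: "expectation (\<lambda>\<omega>. e i \<omega> * e i \<omega>) = expectation (\<lambda>\<omega>. e 0 \<omega> * e 0 \<omega>)" for i
  proof -
    have "expectation (\<lambda>\<omega>. e i \<omega> * e i \<omega>) = integral\<^sup>L (distr M borel (e i)) (\<lambda>x. x * x)" for i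
      by (subst integral_distr) auto
    then show ?thesis using dist[of i 0] by simp
  qed
  have off: "integrable M (\<lambda>\<omega>. e i \<omega> * e j \<omega>) \<and> expectation (\<lambda>\<omega>. e i \<omega> * e j \<omega>) = 0"
    if "i \<noteq> j" for i j
  proof -
    have "indep_vars (\<lambda>_. borel) e {i, j}" using ind by (rule indep_vars_subset) simp
    from indep_vars_integrable[OF _ this] indep_vars_lebesgue_integral[OF _ this]
    show ?thesis using that int1 zero by simp
  qed
  show ?thesis
    by (rule that[of "expectation (\<lambda>\<omega>. e 0 \<omega> * e 0 \<omega>)"])
      (use meas int2 var off in \<open>auto simp: white_noise_def\<close>)
qed

lemma white_noise_nonneg: "white_noise M v e \<Longrightarrow> 0 \<le> v"
proof -
  assume "white_noise M v e"
  then have "v = (\<integral>\<omega>. e 0 \<omega> * e 0 \<omega> \<partial>M)" by (simp add: white_noise_def)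
  then show ?thesis by simp
qed

lemma white_noise_sum_squared:
  assumes e: "white_noise M v e" and f: "inj_on f I"
  shows "integrable M (\<lambda>\<omega>. (\<Sum>i\<in>I. c i * e (f i) \<omega>)\<^sup>2)"
    and "(\<integral>\<omega>. (\<Sum>i\<in>I. c i * e (f i) \<omega>)\<^sup>2 \<partial>M) = v * (\<Sum>i\<in>I. (c i)\<^sup>2)"
proof -
  have int: "integrable M (\<lambda>\<omega>. e i \<omega> * e j \<omega>)"
    and ex: "(\<integral>\<omega>. e i \<omega> * e j \<omega> \<partial>M) = (if i = j then v else 0)" for i j
    using e by (auto simp: white_noise_def)
  have sq: "(\<Sum>i\<in>I. c i * e (f i) \<omega>)\<^sup>2 = (\<Sum>i\<in>I. \<Sum>j\<in>I. (c i * c j) * (e (f i) \<omega> * e (f j) \<omega>))" for \<omega>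
    by (simp add: power2_eq_square sum_product mult_ac)
  show "integrable M (\<lambda>\<omega>. (\<Sum>i\<in>I. c i * e (f i) \<omega>)\<^sup>2)"
    unfolding sq by (intro Bochner_Integration.integrable_sum integrable_mult_right int)
  have "(\<integral>\<omega>. (\<Sum>i\<in>I. c i * e (f i) \<omega>)\<^sup>2 \<partial>M) = (\<Sum>i\<in>I. \<Sum>j\<in>I. (c i * c j) * (if f i = f j then v else 0))"
    unfolding sq by (simp add: Bochner_Integration.integral_sum int ex integrable_mult_right)
  also have "\<dots> = (\<Sum>i\<in>I. \<Sum>j\<in>I. if i = j then v * (c i)\<^sup>2 else 0)"
    using f by (intro sum.cong refl) (auto simp: inj_on_eq_iff power2_eq_square)
  also have "\<dots> = v * (\<Sum>i\<in>I. (c i)\<^sup>2)"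
    by (cases "finite I") (simp_all add: sum_distrib_left)
  finally show "(\<integral>\<omega>. (\<Sum>i\<in>I. c i * e (f i) \<omega>)\<^sup>2 \<partial>M) = v * (\<Sum>i\<in>I. (c i)\<^sup>2)" .
qed

text \<open>
  The series of a moving average is given as an almost sure limit; Fatou's lemma transfers the second
  moments of its partial sums to the limit.
\<close>

lemma moving_average_tail:
  assumes e: "white_noise M v e" and a: "summable (\<lambda>j. (a j)\<^sup>2)"
    and Z[measurable]: "Z \<in> borel_measurable M"
    and sums: "AE \<omega> in M. (\<lambda>j. a j * e (t - int j) \<omega>) sums Z \<omega>"
  shows "integrable M (\<lambda>\<omega>. (Z \<omega> - (\<Sum>j<J. a j * e (t - int j) \<omega>))\<^sup>2)"
    and "(\<integral>\<omega>. (Z \<omega> - (\<Sum>j<J. a j * e (t - int j) \<omega>))\<^sup>2 \<partial>M) \<le> v * (\<Sum>j. (a (j + J))\<^sup>2)"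
proof -
  let ?R = "\<lambda>\<omega>. (Z \<omega> - (\<Sum>j<J. a j * e (t - int j) \<omega>))\<^sup>2"
  let ?P = "\<lambda>K \<omega>. (\<Sum>j=J..<K. a j * e (t - int j) \<omega>)\<^sup>2"
  let ?tail = "\<Sum>j. (a (j + J))\<^sup>2"
  have [measurable]: "e i \<in> borel_measurable M" for i using e by (simp add: white_noise_def)
  have v: "0 \<le> v" using e by (rule white_noise_nonneg)
  have tail: "(\<Sum>j=J..<K. (a j)\<^sup>2) \<le> ?tail" for K
  proof -
    have "(\<Sum>j=J..<K. (a j)\<^sup>2) = (\<Sum>j<K - J. (a (j + J))\<^sup>2)"
      by (rule sum.reindex_bij_witness[of _ "\<lambda>j. j + J" "\<lambda>j. j - J"]) auto
    also have "\<dots> \<le> ?tail"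
      using a by (intro sum_le_suminf) (auto simp: summable_iff_shift[of "\<lambda>j. (a j)\<^sup>2"])
    finally show ?thesis .
  qed
  then have tail0: "0 \<le> ?tail" using tail[of J] by simp
  have part: "(\<integral>\<^sup>+\<omega>. ennreal (?P K \<omega>) \<partial>M) \<le> ennreal (v * ?tail)" for K
  proof -
    have inj: "inj_on (\<lambda>j. t - int j) {J..<K}" by (auto simp: inj_on_def)
    have "(\<integral>\<^sup>+\<omega>. ennreal (?P K \<omega>) \<partial>M) = ennreal (\<integral>\<omega>. ?P K \<omega> \<partial>M)"
      by (rule nn_integral_eq_integral) (use white_noise_sum_squared(1)[OF e inj] in auto)
    also have "(\<integral>\<omega>. ?P K \<omega> \<partial>M) = v * (\<Sum>j=J..<K. (a j)\<^sup>2)"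
      by (rule white_noise_sum_squared(2)[OF e inj])
    also have "ennreal \<dots> \<le> ennreal (v * ?tail)"
      using v tail by (intro ennreal_leI mult_left_mono)
    finally show ?thesis .
  qed
  have lim: "AE \<omega> in M. liminf (\<lambda>K. ennreal (?P K \<omega>)) = ennreal (?R \<omega>)"
    using sums
  proof eventually_elim
    case (elim \<omega>)
    let ?x = "\<lambda>j. a j * e (t - int j) \<omega>"
    have "(\<lambda>K. (\<Sum>j<K. ?x j) - (\<Sum>j<J. ?x j)) \<longlonglongrightarrow> Z \<omega> - (\<Sum>j<J. ?x j)"
      using elim by (intro tendsto_diff tendsto_const) (simp add: sums_def)
    moreover have "eventually (\<lambda>K. (\<Sum>j<K. ?x j) - (\<Sum>j<J. ?x j) = (\<Sum>j=J..<K. ?x j)) sequentially"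
      using eventually_ge_at_top[of J]
    proof eventually_elim
      case (elim K)
      then have "{..<K} = {..<J} \<union> {J..<K}" by auto
      then show ?case by (simp add: sum.union_disjoint ivl_disj_int)
    qed
    ultimately have "(\<lambda>K. \<Sum>j=J..<K. ?x j) \<longlonglongrightarrow> Z \<omega> - (\<Sum>j<J. ?x j)"
      by (rule Lim_transform_eventually)
    then have "(\<lambda>K. ennreal (?P K \<omega>)) \<longlonglongrightarrow> ennreal (?R \<omega>)"
      by (intro tendsto_ennrealI tendsto_power)
    then show ?case by (rule lim_imp_Liminf[OF sequentially_bot])
  qed
  have "(\<integral>\<^sup>+\<omega>. ennreal (?R \<omega>) \<partial>M) = (\<integral>\<^sup>+\<omega>. liminf (\<lambda>K. ennreal (?P K \<omega>)) \<partial>M)"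
    by (rule nn_integral_cong_AE) (use lim in \<open>eventually_elim; simp\<close>)
  also have "\<dots> \<le> liminf (\<lambda>K. \<integral>\<^sup>+\<omega>. ennreal (?P K \<omega>) \<partial>M)"
    by (rule nn_integral_liminf) simp
  also have "\<dots> \<le> limsup (\<lambda>K. \<integral>\<^sup>+\<omega>. ennreal (?P K \<omega>) \<partial>M)"
    by (rule Liminf_le_Limsup) simp
  also have "\<dots> \<le> ennreal (v * ?tail)"
    by (rule Limsup_bounded) (use part in simp)
  finally have nn: "(\<integral>\<^sup>+\<omega>. ennreal (?R \<omega>) \<partial>M) \<le> ennreal (v * ?tail)" .
  show int: "integrable M ?R"
    by (rule integrableI_bounded) (use nn in \<open>auto intro: le_less_trans\<close>)
  have "ennreal (\<integral>\<omega>. ?R \<omega> \<partial>M) \<le> ennreal (v * ?tail)"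
    using nn nn_integral_eq_integral[OF int] by simp
  then show "(\<integral>\<omega>. ?R \<omega> \<partial>M) \<le> v * ?tail"
    using v tail0 by (subst (asm) ennreal_le_iff) auto
qed

text \<open>
  A sum of \<open>L\<close> terms of a moving average, with weights bounded by \<open>1\<close>, has second moment \<open>o(L\<^sup>2)\<close>,
  uniformly in the times and the weights. The moving average is cut at a lag \<open>J\<close> whose tail has small
  second moment. By the Cauchy-Schwarz inequality the tails contribute a small multiple of \<open>L\<^sup>2\<close>. The
  heads are \<open>J\<close> weighted sums of white noise, and each of them has second moment at most \<open>v * L\<close> by
  orthogonality.
\<close>

lemma moving_average_weighted_sum:
  fixes Y :: "int \<Rightarrow> 'a \<Rightarrow> real"
  assumes e: "white_noise M v e" and a: "summable (\<lambda>j. (a j)\<^sup>2)"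
    and Y[measurable]: "\<And>t. Y t \<in> borel_measurable M"
    and sums: "\<And>t. AE \<omega> in M. (\<lambda>j. a j * e (t - int j) \<omega>) sums Y t \<omega>"
    and eps: "\<epsilon> > 0"
  shows "\<exists>L0. \<forall>L\<ge>L0. \<forall>(T::nat set) w. card T = L \<longrightarrow> (\<forall>t\<in>T. \<bar>w t\<bar> \<le> (1::real)) \<longrightarrow>
     integrable M (\<lambda>\<omega>. (\<Sum>t\<in>T. w t * Y (int t) \<omega>)\<^sup>2) \<and>
     (\<integral>\<omega>. (\<Sum>t\<in>T. w t * Y (int t) \<omega>)\<^sup>2 \<partial>M) \<le> \<epsilon> * (real L)\<^sup>2"
proof -
  have v: "0 \<le> v" using e by (rule white_noise_nonneg)
  have "(\<lambda>J. v * (\<Sum>j. (a (j + J))\<^sup>2)) \<longlonglongrightarrow> v * 0"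
    by (intro tendsto_mult tendsto_const suminf_exist_split2[OF a])
  then have "eventually (\<lambda>J. v * (\<Sum>j. (a (j + J))\<^sup>2) < \<epsilon> / 4) sequentially"
    using eps by (intro order_tendstoD) auto
  then obtain J where J: "v * (\<Sum>j. (a (j + J))\<^sup>2) < \<epsilon> / 4"
    by (auto simp: eventually_at_top_linorder)
  define A where "A = (\<Sum>j<J. (a j)\<^sup>2)"
  have A: "0 \<le> A" by (simp add: A_def sum_nonneg)
  \<comment> \<open>For \<open>L \<ge> L0\<close> the heads contribute at most \<open>\<epsilon> / 2 * L\<^sup>2\<close>.\<close>
  define L0 where "L0 = nat \<lceil>4 * A * J * v / \<epsilon>\<rceil>"
  have main: "integrable M (\<lambda>\<omega>. (\<Sum>t\<in>T. w t * Y (int t) \<omega>)\<^sup>2) \<and>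
     (\<integral>\<omega>. (\<Sum>t\<in>T. w t * Y (int t) \<omega>)\<^sup>2 \<partial>M) \<le> \<epsilon> * (real L)\<^sup>2"
    if L: "L \<ge> L0" and T: "card T = L" and w: "\<forall>t\<in>T. \<bar>w t\<bar> \<le> (1::real)" for L T and w :: "nat \<Rightarrow> real"
  proof -
    have w2: "(w t)\<^sup>2 \<le> 1" if "t \<in> T" for t
      using w that by (simp add: abs_square_le_1)
    define R where "R t \<omega> = Y (int t) \<omega> - (\<Sum>j<J. a j * e (int t - int j) \<omega>)" for t \<omega>
    have R: "integrable M (\<lambda>\<omega>. (R t \<omega>)\<^sup>2)" "(\<integral>\<omega>. (R t \<omega>)\<^sup>2 \<partial>M) \<le> \<epsilon> / 4" for t
      using moving_average_tail[OF e a Y sums, of "int t" J] J unfolding R_def by auto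
    define S where "S j \<omega> = (\<Sum>t\<in>T. w t * e (int t - int j) \<omega>)" for j :: nat and \<omega>
    have S: "integrable M (\<lambda>\<omega>. (S j \<omega>)\<^sup>2)" "(\<integral>\<omega>. (S j \<omega>)\<^sup>2 \<partial>M) \<le> v * real L" for j
    proof -
      have inj: "inj_on (\<lambda>t. int t - int j) T" by (auto simp: inj_on_def)
      show "integrable M (\<lambda>\<omega>. (S j \<omega>)\<^sup>2)"
        unfolding S_def by (rule white_noise_sum_squared(1)[OF e inj])
      have "(\<Sum>t\<in>T. (w t)\<^sup>2) \<le> (\<Sum>t\<in>T. 1)" by (intro sum_mono w2)
      then have "(\<Sum>t\<in>T. (w t)\<^sup>2) \<le> real L" using T by simp
      then show "(\<integral>\<omega>. (S j \<omega>)\<^sup>2 \<partial>M) \<le> v * real L"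
        unfolding S_def white_noise_sum_squared(2)[OF e inj] using v by (rule mult_left_mono)
    qed
    define b where "b \<omega> = 2 * (A * (\<Sum>j<J. (S j \<omega>)\<^sup>2)) + 2 * ((\<Sum>t\<in>T. (R t \<omega>)\<^sup>2) * real L)" for \<omega>
    have bint: "integrable M b"
      unfolding b_def using S(1) R(1) by (intro Bochner_Integration.integrable_add integrable_mult_right
         integrable_mult_left Bochner_Integration.integrable_sum) auto
    have le: "(\<Sum>t\<in>T. w t * Y (int t) \<omega>)\<^sup>2 \<le> b \<omega>" for \<omega>
    proof -
      have "(\<Sum>t\<in>T. w t * Y (int t) \<omega>) = (\<Sum>t\<in>T. w t * (\<Sum>j<J. a j * e (int t - int j) \<omega>)) + (\<Sum>t\<in>T. w t * R t \<omega>)"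
        by (simp add: R_def sum.distrib[symmetric] algebra_simps)
      also have "(\<Sum>t\<in>T. w t * (\<Sum>j<J. a j * e (int t - int j) \<omega>)) = (\<Sum>j<J. a j * S j \<omega>)"
        unfolding S_def sum_distrib_left by (subst sum.swap) (simp add: mult_ac)
      finally have eq: "(\<Sum>t\<in>T. w t * Y (int t) \<omega>) = (\<Sum>j<J. a j * S j \<omega>) + (\<Sum>t\<in>T. w t * R t \<omega>)" .
      have "(x + y)\<^sup>2 \<le> 2 * x\<^sup>2 + 2 * y\<^sup>2" for x y :: real
        using sum_squares_bound[of x y] by (simp add: power2_sum)
      then have "(\<Sum>t\<in>T. w t * Y (int t) \<omega>)\<^sup>2 \<le> 2 * (\<Sum>j<J. a j * S j \<omega>)\<^sup>2 + 2 * (\<Sum>t\<in>T. w t * R t \<omega>)\<^sup>2"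
        unfolding eq .
      moreover have "(\<Sum>j<J. a j * S j \<omega>)\<^sup>2 \<le> A * (\<Sum>j<J. (S j \<omega>)\<^sup>2)"
        unfolding A_def by (rule Cauchy_Schwarz_ineq_sum)
      moreover have "(\<Sum>t\<in>T. w t * R t \<omega>)\<^sup>2 \<le> (\<Sum>t\<in>T. (R t \<omega>)\<^sup>2) * real L"
      proof -
        have "(\<Sum>t\<in>T. w t * R t \<omega>)\<^sup>2 \<le> (\<Sum>t\<in>T. (w t * R t \<omega>)\<^sup>2) * real L"
          using sum_squared_le_sum_of_squares[of "\<lambda>t. w t * R t \<omega>" T] T by simp
        also have "\<dots> \<le> (\<Sum>t\<in>T. (R t \<omega>)\<^sup>2) * real L"
          using w2 by (intro mult_right_mono sum_mono) (auto simp: power_mult_distrib mult_left_le_one_le)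
        finally show ?thesis .
      qed
      ultimately show ?thesis unfolding b_def by linarith
    qed
    have "(\<integral>\<omega>. b \<omega> \<partial>M) = 2 * (A * (\<Sum>j<J. \<integral>\<omega>. (S j \<omega>)\<^sup>2 \<partial>M)) + 2 * ((\<Sum>t\<in>T. \<integral>\<omega>. (R t \<omega>)\<^sup>2 \<partial>M) * real L)"
      unfolding b_def using S(1) R(1) by (simp add: Bochner_Integration.integral_sum)
    also have "\<dots> \<le> 2 * (A * (\<Sum>j<J. v * real L)) + 2 * ((\<Sum>t\<in>T. \<epsilon> / 4) * real L)"
      using S(2) R(2) A by (intro add_mono mult_left_mono mult_right_mono sum_mono) auto
    also have "\<dots> = 2 * A * J * v * real L + \<epsilon> / 2 * (real L)\<^sup>2"
      using T by (simp add: power2_eq_square)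
    also have "2 * A * J * v * real L \<le> \<epsilon> / 2 * (real L)\<^sup>2"
    proof -
      have "4 * A * J * v / \<epsilon> \<le> real L" using L unfolding L0_def by linarith
      then have "4 * A * J * v \<le> \<epsilon> * real L" using eps by (simp add: field_simps)
      then have "4 * A * J * v * real L \<le> \<epsilon> * real L * real L" by (rule mult_right_mono) simp
      then show ?thesis by (simp add: power2_eq_square)
    qed
    finally have b: "(\<integral>\<omega>. b \<omega> \<partial>M) \<le> \<epsilon> * (real L)\<^sup>2" by simp
    have int: "integrable M (\<lambda>\<omega>. (\<Sum>t\<in>T. w t * Y (int t) \<omega>)\<^sup>2)"
      by (rule Bochner_Integration.integrable_bound[OF bint]) (use le in \<open>auto intro!: AE_I2 order_trans[OF _ abs_ge_self]\<close>)
    then show ?thesis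
      using order_trans[OF integral_mono[OF int bint le] b] by simp
  qed
  then show ?thesis by (intro exI[of _ L0]) blast
qed

lemma moving_average_fourier_sum:
  fixes Y :: "int \<Rightarrow> 'a \<Rightarrow> real"
  assumes "white_noise M v e" and "summable (\<lambda>j. (a j)\<^sup>2)"
    and "\<And>t. Y t \<in> borel_measurable M"
    and "\<And>t. AE \<omega> in M. (\<lambda>j. a j * e (t - int j) \<omega>) sums Y t \<omega>"
    and "\<epsilon> > 0"
  shows "\<forall>\<^sub>F L in sequentially. \<forall>(T::nat set) \<theta>. card T = L \<longrightarrow>
     integrable M (\<lambda>\<omega>. (cmod (\<Sum>t\<in>T. of_real (Y (int t) \<omega>) * exp (\<i> * of_real (real t * \<theta>))))\<^sup>2) \<and>
     (\<integral>\<omega>. (cmod (\<Sum>t\<in>T. of_real (Y (int t) \<omega>) * exp (\<i> * of_real (real t * \<theta>))))\<^sup>2 \<partial>M) \<le> \<epsilon> * (real L)\<^sup>2"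
proof -
  have eq: "(cmod (\<Sum>t\<in>T. of_real (Y (int t) \<omega>) * exp (\<i> * of_real (real t * \<theta>))))\<^sup>2 =
     (\<Sum>t\<in>T. cos (real t * \<theta>) * Y (int t) \<omega>)\<^sup>2 + (\<Sum>t\<in>T. sin (real t * \<theta>) * Y (int t) \<omega>)\<^sup>2"
    for T :: "nat set" and \<theta> \<omega>
    by (simp add: cmod_power2 Re_sum Im_sum Re_exp Im_exp mult.commute)
  obtain L0 where L0: "\<And>L T w. L \<ge> L0 \<Longrightarrow> card (T::nat set) = L \<Longrightarrow> (\<forall>t\<in>T. \<bar>w t\<bar> \<le> (1::real)) \<Longrightarrow>
     integrable M (\<lambda>\<omega>. (\<Sum>t\<in>T. w t * Y (int t) \<omega>)\<^sup>2) \<and>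
     (\<integral>\<omega>. (\<Sum>t\<in>T. w t * Y (int t) \<omega>)\<^sup>2 \<partial>M) \<le> \<epsilon> / 2 * (real L)\<^sup>2"
    using moving_average_weighted_sum[OF assms(1-4) half_gt_zero[OF assms(5)]] by blast
  show ?thesis
    unfolding eventually_at_top_linorder
  proof (intro exI[of _ L0] allI impI)
    fix L and T :: "nat set" and \<theta> :: real assume L: "L0 \<le> L" and T: "card T = L"
    have c: "integrable M (\<lambda>\<omega>. (\<Sum>t\<in>T. cos (real t * \<theta>) * Y (int t) \<omega>)\<^sup>2)"
      "(\<integral>\<omega>. (\<Sum>t\<in>T. cos (real t * \<theta>) * Y (int t) \<omega>)\<^sup>2 \<partial>M) \<le> \<epsilon> / 2 * (real L)\<^sup>2"
      using L0[OF L T, of "\<lambda>t. cos (real t * \<theta>)"] by auto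
    have s: "integrable M (\<lambda>\<omega>. (\<Sum>t\<in>T. sin (real t * \<theta>) * Y (int t) \<omega>)\<^sup>2)"
      "(\<integral>\<omega>. (\<Sum>t\<in>T. sin (real t * \<theta>) * Y (int t) \<omega>)\<^sup>2 \<partial>M) \<le> \<epsilon> / 2 * (real L)\<^sup>2"
      using L0[OF L T, of "\<lambda>t. sin (real t * \<theta>)"] by auto
    show "integrable M (\<lambda>\<omega>. (cmod (\<Sum>t\<in>T. of_real (Y (int t) \<omega>) * exp (\<i> * of_real (real t * \<theta>))))\<^sup>2) \<and>
     (\<integral>\<omega>. (cmod (\<Sum>t\<in>T. of_real (Y (int t) \<omega>) * exp (\<i> * of_real (real t * \<theta>))))\<^sup>2 \<partial>M) \<le> \<epsilon> * (real L)\<^sup>2"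
      unfolding eq using c s by simp
  qed
qed

section \<open>Lower bounds for the statistic\<close>

text \<open>
  The denominator \<open>d\<close> may vanish or be negative: the right-hand side is then infinite, or \<open>b = 0\<close> and
  both sides are \<open>0\<close>.
\<close>

lemma ennreal_divide_mono:
  fixes a b c d :: real
  assumes "0 \<le> a" "a \<le> b" "0 < c" "d \<le> c"
  shows "ennreal a / ennreal c \<le> ennreal b / ennreal d"
proof (cases "0 < d")
  case True
  then show ?thesis using assms by (simp add: divide_ennreal frac_le)
next
  case False
  then have "ennreal d = 0" by (simp add: ennreal_neg)
  then show ?thesis using assms by (cases "b = 0") (auto simp: ennreal_divide_zero ennreal_divide_eq_top_iff)
qed

text \<open>
  Any one of the \<open>s\<close> quotients bounds the statistic from below; the factor \<open>1 / m\<close> is the worst case of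
  \<open>m powr (-2 * \<delta>)\<close>, attained at \<open>\<delta> = 1/2\<close>.
\<close>

lemma Q_stat_lower_bound:
  assumes m: "m > 0" and j: "j \<in> {1..s}" and \<delta>: "\<delta> \<le> 1/2"
    and num: "0 \<le> A" "A \<le> periodogram x (m * l) (fourier_freq (m * l) j)"
    and den: "0 < D" "1 / real m * (\<Sum>h=1..m. block_periodogram x l h (fourier_freq l j)) \<le> D"
  shows "ennreal (A / (real m * D)) \<le> Q_stat x m l s \<delta>"
proof -
  let ?I = "\<lambda>j. ennreal (periodogram x (m * l) (fourier_freq (m * l) j))"
  let ?B = "\<lambda>j. ennreal (1 / real m * (\<Sum>h=1..m. block_periodogram x l h (fourier_freq l j)))"
  have pw: "1 / real m \<le> real m powr (-2 * \<delta>)"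
  proof -
    have "real m powr (-1) \<le> real m powr (-2 * \<delta>)"
      using m \<delta> by (intro powr_mono) auto
    then show ?thesis using m by (simp add: powr_minus_divide)
  qed
  have "ennreal (A / (real m * D)) = ennreal (1 / real m) * (ennreal A / ennreal D)"
    using m num(1) den(1) by (simp add: divide_ennreal ennreal_mult[symmetric])
  also have "ennreal A / ennreal D \<le> ?I j / ?B j"
    using num den(1) den(2) by (rule ennreal_divide_mono)
  also have "?I j / ?B j \<le> (\<Sum>j=1..s. ?I j / ?B j)"
    using j by (intro member_le_sum) auto
  also have "ennreal (1 / real m) * (\<Sum>j=1..s. ?I j / ?B j) \<le> Q_stat x m l s \<delta>"
    unfolding Q_stat_def using pw by (intro mult_right_mono ennreal_leI) auto
  finally show ?thesis by (simp add: mult_left_mono)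
qed

text \<open>
  The pathwise core of the argument, with \<open>y\<close> a realization of the noise. Here \<open>\<kappa>\<close> stands for the modulus of
  the Fourier coefficient of \<open>g\<close>. The numerator of the \<open>j\<close>-th quotient is at least of order
  \<open>\<kappa>\<^sup>2 * n powr (2 * \<beta> + 1)\<close> and its denominator at most of order \<open>\<epsilon> * l * n powr (2 * \<beta>)\<close>, so that the
  quotient exceeds a multiple of \<open>m * \<kappa>\<^sup>2 / \<epsilon>\<close>, and the factor \<open>m\<close> absorbs the normalization.
\<close>

lemma Q_stat_large:
  fixes y :: "nat \<Rightarrow> real"
  defines "E \<equiv> \<lambda>w t. exp (\<i> * of_real (real t * w))"
  assumes m: "m > 0" and n: "n = m * l" and j: "j \<in> {1..s}" "j < l"
    and \<delta>: "\<delta> \<le> 1/2" and \<beta>: "\<beta> \<ge> 0" and \<kappa>: "\<kappa> > 0" and \<epsilon>: "\<epsilon> > 0"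
    and trend: "3/4 * \<kappa> * real n * real n powr \<beta>
                  \<le> cmod (\<Sum>t=1..n. of_real (trend \<beta> g n t) * E (fourier_freq n j) t)"
    and osc: "1 / real n * (\<Sum>h=1..m. \<Sum>t=(h - 1) * l + 1..h * l.
                  (g (real t / real n) - g (real h / real m))\<^sup>2) \<le> \<epsilon>"
    and noise: "(cmod (\<Sum>t=1..n. of_real (y t) * E (fourier_freq n j) t))\<^sup>2 \<le> (\<kappa> / 4 * real n)\<^sup>2"
    and noise_blocks: "(\<Sum>h=1..m. (cmod (\<Sum>t=(h - 1) * l + 1..h * l.
                          of_real (y t) * E (fourier_freq l j) t))\<^sup>2) \<le> \<epsilon> * real m * (real l)\<^sup>2"
  shows "ennreal (\<kappa>\<^sup>2 / (16 * \<epsilon>)) \<le> Q_stat (\<lambda>t. trend \<beta> g n t + y t) m l s \<delta>"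
proof -
  let ?x = "\<lambda>t. trend \<beta> g n t + y t" and ?b = "real n powr \<beta>"
  have l: "l > 0" using j by auto
  have n0: "n > 0" using n m l by simp
  have nr: "real n = real m * real l" using n by simp
  have b1: "1 \<le> ?b" using \<beta> n0 by (intro ge_one_powr_ge_zero) auto
  have split: "(\<Sum>t\<in>T. of_real (?x t) * E w t)
      = (\<Sum>t\<in>T. of_real (trend \<beta> g n t) * E w t) + (\<Sum>t\<in>T. of_real (y t) * E w t)" for T w
    by (simp add: distrib_right sum.distrib)
  define A where "A = 1 / (2 * pi * real n) * (\<kappa> / 2 * real n * ?b)\<^sup>2"
  define D where "D = 2 * \<epsilon> * real l * ?b\<^sup>2 / pi"
  have AD: "0 \<le> A" "0 < D" unfolding A_def D_def using \<epsilon> l n0 by auto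
  have "A \<le> periodogram ?x n (fourier_freq n j)"
  proof -
    let ?G = "\<Sum>t=1..n. of_real (trend \<beta> g n t) * E (fourier_freq n j) t"
      and ?T = "\<Sum>t=1..n. of_real (y t) * E (fourier_freq n j) t"
    have "cmod ?T \<le> \<kappa> / 4 * real n" using noise \<kappa> by (simp add: power2_le_iff_abs_le)
    also have "\<dots> \<le> \<kappa> / 4 * real n * ?b" using b1 \<kappa> mult_left_mono[OF b1, of "\<kappa> / 4 * real n"] by simp
    finally have "\<kappa> / 2 * real n * ?b \<le> cmod ?G - cmod ?T" using trend by simp
    also have "\<dots> \<le> cmod (?G + ?T)" by (rule norm_diff_ineq)
    finally have "(\<kappa> / 2 * real n * ?b)\<^sup>2 \<le> (cmod (?G + ?T))\<^sup>2" using \<kappa> by (intro power_mono) auto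
    then have "A \<le> 1 / (2 * pi * real n) * (cmod (?G + ?T))\<^sup>2"
      unfolding A_def by (intro mult_left_mono) auto
    also have "\<dots> = periodogram ?x n (fourier_freq n j)"
      unfolding periodogram_def split[symmetric] by (simp only: E_def)
    finally show ?thesis .
  qed
  moreover have "1 / real m * (\<Sum>h=1..m. block_periodogram ?x l h (fourier_freq l j)) \<le> D"
  proof -
    let ?G = "\<lambda>h. \<Sum>t=(h - 1) * l + 1..h * l. of_real (trend \<beta> g n t) * E (fourier_freq l j) t"
      and ?T = "\<lambda>h. \<Sum>t=(h - 1) * l + 1..h * l. of_real (y t) * E (fourier_freq l j) t"
    have "(\<Sum>h=1..m. (cmod (?G h))\<^sup>2) \<le> ?b\<^sup>2 * real l * (\<Sum>h=1..m. \<Sum>t=(h - 1) * l + 1..h * l.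
                  (g (real t / real n) - g (real h / real m))\<^sup>2)"
      unfolding n E_def using j m by (intro trend_block_sum_bound) auto
    also have "\<dots> \<le> ?b\<^sup>2 * real l * (\<epsilon> * real n)"
      using osc n0 by (intro mult_left_mono) (auto simp: field_simps)
    finally have G: "(\<Sum>h=1..m. (cmod (?G h))\<^sup>2) \<le> \<epsilon> * real m * (real l)\<^sup>2 * ?b\<^sup>2"
      by (simp add: nr power2_eq_square mult_ac)
    have "\<epsilon> * real m * (real l)\<^sup>2 * 1 \<le> \<epsilon> * real m * (real l)\<^sup>2 * ?b\<^sup>2"
      using b1 \<epsilon> by (intro mult_left_mono) (auto intro: one_le_power)
    with noise_blocks have T: "(\<Sum>h=1..m. (cmod (?T h))\<^sup>2) \<le> \<epsilon> * real m * (real l)\<^sup>2 * ?b\<^sup>2" by linarith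
    have sq: "(cmod (u + v))\<^sup>2 \<le> 2 * (cmod u)\<^sup>2 + 2 * (cmod v)\<^sup>2" for u v
    proof -
      have "(cmod (u + v))\<^sup>2 \<le> (cmod u + cmod v)\<^sup>2" by (intro power_mono norm_triangle_ineq) simp
      also have "\<dots> \<le> 2 * (cmod u)\<^sup>2 + 2 * (cmod v)\<^sup>2"
        using sum_squares_bound[of "cmod u" "cmod v"] by (simp add: power2_sum)
      finally show ?thesis .
    qed
    have "(\<Sum>h=1..m. (cmod (?G h + ?T h))\<^sup>2) \<le> (\<Sum>h=1..m. 2 * (cmod (?G h))\<^sup>2 + 2 * (cmod (?T h))\<^sup>2)"
      by (intro sum_mono sq)
    also have "\<dots> = 2 * (\<Sum>h=1..m. (cmod (?G h))\<^sup>2) + 2 * (\<Sum>h=1..m. (cmod (?T h))\<^sup>2)"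
      by (simp only: sum.distrib sum_distrib_left)
    also have "\<dots> \<le> 4 * (\<epsilon> * real m * (real l)\<^sup>2 * ?b\<^sup>2)" using G T by linarith
    finally have "1 / real m * (1 / (2 * pi * real l) * (\<Sum>h=1..m. (cmod (?G h + ?T h))\<^sup>2))
        \<le> 1 / real m * (1 / (2 * pi * real l) * (4 * (\<epsilon> * real m * (real l)\<^sup>2 * ?b\<^sup>2)))"
      by (intro mult_left_mono) auto
    also have "\<dots> = D" unfolding D_def using m l by (simp add: field_simps power2_eq_square)
    moreover have "block_periodogram ?x l h (fourier_freq l j)
        = 1 / (2 * pi * real l) * (cmod (?G h + ?T h))\<^sup>2" for h
      unfolding block_periodogram_def split[symmetric] by (simp only: E_def)
    ultimately show ?thesis by (simp only: sum_distrib_left)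
  qed
  ultimately have "ennreal (A / (real m * D)) \<le> Q_stat ?x m l s \<delta>"
    using m j(1) \<delta> AD unfolding n by (intro Q_stat_lower_bound)
  moreover have "A / (real m * D) = \<kappa>\<^sup>2 / (16 * \<epsilon>)"
    using m l b1 \<epsilon> unfolding A_def D_def nr by (simp add: field_simps power2_eq_square)
  ultimately show ?thesis by simp
qed

section \<open>Divergence of the statistic\<close>

lemma Q_stat_measurable:
  assumes "\<And>t. X t \<in> borel_measurable M"
  shows "(\<lambda>\<omega>. Q_stat (\<lambda>t. X t \<omega>) m l s \<delta>) \<in> borel_measurable M"
  using assms unfolding Q_stat_def periodogram_def block_periodogram_def by measurable

text \<open>
  The noise enters only through its representation as a square-summable moving average of white
  noise, whatever the decay of its coefficients.
\<close>

lemma Q_stat_diverges_along_sequence: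
  fixes Y :: "int \<Rightarrow> 'a \<Rightarrow> real" and g :: "real \<Rightarrow> real" and m l :: "nat \<Rightarrow> nat"
  assumes M: "prob_space M" and e: "white_noise M v e" and a: "summable (\<lambda>j. (a j)\<^sup>2)"
    and Y: "\<And>t. Y t \<in> borel_measurable M"
    and sums: "\<And>t. AE \<omega> in M. (\<lambda>j. a j * e (t - int j) \<omega>) sums Y t \<omega>"
    and \<beta>: "\<beta> \<ge> 0" and \<delta>: "\<delta> \<le> 1/2"
    and S: "finite S" "\<And>x. 0 \<le> x \<Longrightarrow> x \<le> 1 \<Longrightarrow> x \<notin> S \<Longrightarrow> isCont g x"
    and B: "\<And>x. 0 \<le> x \<Longrightarrow> x \<le> 1 \<Longrightarrow> \<bar>g x\<bar> \<le> B"
    and j: "j \<in> {1..s}"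
      "integral {0..1} (\<lambda>x. of_real (g x) * exp (\<i> * of_real (2 * pi * real j * x))) \<noteq> (0::complex)"
    and m: "\<And>k. m k > 0" "filterlim m at_top sequentially"
    and l: "\<And>k. l k > 0" "filterlim l at_top sequentially"
    and K: "K > 0"
  shows "(\<lambda>k. measure M {\<omega> \<in> space M. ennreal K <
            Q_stat (\<lambda>t. trend \<beta> g (m k * l k) t + Y (int t) \<omega>) (m k) (l k) s \<delta>}) \<longlonglongrightarrow> 1"
proof (rule LIMSEQ_I)
  interpret prob_space M by (rule M)
  note [measurable] = Y
  define E where "E w t = exp (\<i> * of_real (real t * w))" for w :: real and t :: nat
  define n where "n k = m k * l k" for k
  have n: "n k > 0" "n k \<ge> m k" for k using m(1)[of k] l(1)[of k] by (auto simp: n_def)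
  have n_inf: "filterlim n at_top sequentially"
    by (rule filterlim_at_top_mono[OF m(2)]) (simp add: n)
  define Q where "Q k \<omega> = Q_stat (\<lambda>t. trend \<beta> g (n k) t + Y (int t) \<omega>) (m k) (l k) s \<delta>" for k \<omega>
  define \<kappa> where "\<kappa> = cmod (integral {0..1} (\<lambda>x. of_real (g x) * exp (\<i> * of_real (2 * pi * real j * x))))"
  have \<kappa>: "\<kappa> > 0" using j(2) by (simp add: \<kappa>_def)
  \<comment> \<open>With this \<open>\<epsilon>\<close> the pathwise lower bound \<open>\<kappa>\<^sup>2 / (16 * \<epsilon>)\<close> is \<open>2 * K\<close>.\<close>
  define \<epsilon> where "\<epsilon> = \<kappa>\<^sup>2 / (32 * K)"
  have \<epsilon>: "\<epsilon> > 0" using \<kappa> K by (simp add: \<epsilon>_def)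
  fix r :: real assume r: "r > 0"
  \<comment> \<open>If the mean square of normalized noise sums is at most \<open>\<eta>\<close>, Markov's inequality bounds the
      probability of the exceptional event by \<open>\<eta> * C\<close>.\<close>
  define C where "C = 16 / \<kappa>\<^sup>2 + 1 / \<epsilon>"
  have C: "C > 0" using \<kappa> \<epsilon> by (simp add: C_def add_pos_pos)
  define \<eta> where "\<eta> = r / (2 * C)"
  have \<eta>: "\<eta> > 0" using r C by (simp add: \<eta>_def)
  let ?good = "\<lambda>L. \<forall>(T::nat set) w. card T = L \<longrightarrow>
     integrable M (\<lambda>\<omega>. (cmod (\<Sum>t\<in>T. of_real (Y (int t) \<omega>) * E w t))\<^sup>2) \<and>
     (\<integral>\<omega>. (cmod (\<Sum>t\<in>T. of_real (Y (int t) \<omega>) * E w t))\<^sup>2 \<partial>M) \<le> \<eta> * (real L)\<^sup>2"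
  have good: "eventually ?good sequentially"
    unfolding E_def using e a Y sums \<eta> by (rule moving_average_fourier_sum)
  have ev_trend: "\<forall>\<^sub>F k in sequentially. 3/4 * \<kappa> * real (n k) * real (n k) powr \<beta>
      \<le> cmod (\<Sum>t=1..n k. of_real (trend \<beta> g (n k) t) * E (fourier_freq (n k) j) t)"
  proof -
    have "\<forall>\<^sub>F k in sequentially. 3/4 * \<kappa> < cmod (\<Sum>t=1..n k. of_real (trend \<beta> g (n k) t) *
        E (fourier_freq (n k) j) t) / (real (n k) * real (n k) powr \<beta>)"
      using trend_fourier_sum_tendsto[OF n(1) n_inf S B, of \<beta> j, folded \<kappa>_def E_def] \<kappa>
      by (intro order_tendstoD(1)) auto
    then show ?thesis
    proof eventually_elim
      case (elim k)
      then show ?case using n(1)[of k] by (simp add: pos_less_divide_eq mult_ac)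
    qed
  qed
  have ev_osc: "\<forall>\<^sub>F k in sequentially. 1 / real (n k) * (\<Sum>h=1..m k. \<Sum>t=(h - 1) * l k + 1..h * l k.
                  (g (real t / real (n k)) - g (real h / real (m k)))\<^sup>2) < \<epsilon>"
    unfolding n_def using block_oscillation_tendsto[OF m l(1) S B] \<epsilon> by (rule order_tendstoD(2))
  have "\<forall>\<^sub>F k in sequentially. s < l k"
    using filterlim_at_top[THEN iffD1, rule_format, OF l(2), of "Suc s"] by (simp add: Suc_le_eq)
  with ev_trend ev_osc filterlim_iff[THEN iffD1, rule_format, OF n_inf good]
    filterlim_iff[THEN iffD1, rule_format, OF l(2) good]
  have "\<forall>\<^sub>F k in sequentially. norm (measure M {\<omega> \<in> space M. ennreal K < Q k \<omega>} - 1) < r"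
  proof eventually_elim
    case (elim k)
    have jl: "j < l k" using elim(5) j(1) by auto
    let ?T = "\<lambda>\<omega>. (cmod (\<Sum>t=1..n k. of_real (Y (int t) \<omega>) * E (fourier_freq (n k) j) t))\<^sup>2"
    let ?Th = "\<lambda>h \<omega>. (cmod (\<Sum>t=(h - 1) * l k + 1..h * l k. of_real (Y (int t) \<omega>) * E (fourier_freq (l k) j) t))\<^sup>2"
    let ?W = "\<lambda>\<omega>. \<Sum>h=1..m k. ?Th h \<omega>"
    let ?c1 = "(\<kappa> / 4 * real (n k))\<^sup>2" and ?c2 = "\<epsilon> * real (m k) * (real (l k))\<^sup>2"
    have c: "?c1 > 0" "?c2 > 0" using \<kappa> \<epsilon> n m l by auto
    have T: "integrable M ?T" "expectation ?T \<le> \<eta> * (real (n k))\<^sup>2"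
      using elim(3)[rule_format, of "{1..n k}"] by auto
    have Th: "integrable M (?Th h)" "expectation (?Th h) \<le> \<eta> * (real (l k))\<^sup>2" if "h \<in> {1..m k}" for h
    proof -
      have "card {(h - 1) * l k + 1..h * l k} = l k" using that by (cases h) auto
      from elim(4)[rule_format, OF this] show "integrable M (?Th h)" "expectation (?Th h) \<le> \<eta> * (real (l k))\<^sup>2"
        by auto
    qed
    have W: "integrable M ?W" using Th(1) by (rule Bochner_Integration.integrable_sum)
    have "expectation ?W = (\<Sum>h=1..m k. expectation (?Th h))"
      using Th(1) by (rule Bochner_Integration.integral_sum)
    also have "\<dots> \<le> (\<Sum>h=1..m k. \<eta> * (real (l k))\<^sup>2)" by (rule sum_mono[OF Th(2)])
    finally have EW: "expectation ?W \<le> real (m k) * (\<eta> * (real (l k))\<^sup>2)" by simp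
    let ?A1 = "{\<omega> \<in> space M. ?T \<omega> \<ge> ?c1}" and ?A2 = "{\<omega> \<in> space M. ?W \<omega> \<ge> ?c2}"
    let ?G = "{\<omega> \<in> space M. ennreal K < Q k \<omega>}"
    have [measurable]: "Q k \<in> borel_measurable M"
      unfolding Q_def by (rule Q_stat_measurable) simp
    have mT[measurable]: "?T \<in> borel_measurable M" "?W \<in> borel_measurable M"
      using T(1) W by (auto intro: borel_measurable_integrable)
    have sets: "?G \<in> events" "?A1 \<in> events" "?A2 \<in> events" by measurable
    \<comment> \<open>Off the events \<open>?A1\<close> and \<open>?A2\<close> the noise sums are small and the pathwise bound applies.\<close>
    have "space M - ?G \<subseteq> ?A1 \<union> ?A2"
    proof
      fix \<omega> assume \<omega>: "\<omega> \<in> space M - ?G"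
      show "\<omega> \<in> ?A1 \<union> ?A2"
      proof (rule ccontr)
        assume "\<omega> \<notin> ?A1 \<union> ?A2"
        with \<omega> have small: "?T \<omega> \<le> ?c1" "?W \<omega> \<le> ?c2" by auto
        have "ennreal (\<kappa>\<^sup>2 / (16 * \<epsilon>)) \<le> Q k \<omega>"
          unfolding Q_def
          by (rule Q_stat_large[OF m(1) n_def j(1) jl \<delta> \<beta> \<kappa> \<epsilon>])
             (use elim(1,2) small in \<open>simp_all only: E_def less_imp_le\<close>)
        moreover have "\<kappa>\<^sup>2 / (16 * \<epsilon>) = 2 * K" using \<kappa> K by (simp add: \<epsilon>_def)
        moreover have "ennreal K < ennreal (2 * K)" using K by (simp add: ennreal_less_iff)
        ultimately have "ennreal K < Q k \<omega>" by (simp only: less_le_trans)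
        then show False using \<omega> by simp
      qed
    qed
    then have "prob (space M - ?G) \<le> prob (?A1 \<union> ?A2)"
      using sets by (intro finite_measure_mono) auto
    also have "\<dots> \<le> prob ?A1 + prob ?A2"
      using sets by (intro measure_Un_le) auto
    also have "prob ?A1 \<le> expectation ?T / ?c1"
      by (rule integral_Markov_inequality_measure[OF T(1) sets(1) _ c(1)]) simp
    also have "\<dots> \<le> \<eta> * (real (n k))\<^sup>2 / ?c1"
      using T(2) by (rule divide_right_mono) simp
    also have "prob ?A2 \<le> expectation ?W / ?c2"
      by (rule integral_Markov_inequality_measure[OF W sets(1) _ c(2)]) (simp add: sum_nonneg)
    also have "\<dots> \<le> real (m k) * (\<eta> * (real (l k))\<^sup>2) / ?c2"
      using EW c(2) by (intro divide_right_mono) auto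
    also have "\<eta> * (real (n k))\<^sup>2 / ?c1 + real (m k) * (\<eta> * (real (l k))\<^sup>2) / ?c2 = \<eta> * C"
      using n(1)[of k] m(1)[of k] l(1)[of k] \<kappa> \<epsilon> unfolding C_def
      by (simp add: field_simps power2_eq_square)
    also have "\<dots> = r / 2" using C by (simp add: \<eta>_def)
    finally have "1 - prob ?G \<le> r / 2" using sets by (simp add: prob_compl)
    moreover have "prob ?G \<le> 1" by simp
    ultimately show ?case using r by simp
  qed
  then show "\<exists>k0. \<forall>k\<ge>k0. norm (measure M {\<omega> \<in> space M. ennreal K <
            Q_stat (\<lambda>t. trend \<beta> g (m k * l k) t + Y (int t) \<omega>) (m k) (l k) s \<delta>} - 1) < r"
    by (simp add: eventually_at_top_linorder Q_def n_def)
qed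

theorem proposition2:
  fixes M :: "'a measure"
    and Y :: "int \<Rightarrow> 'a \<Rightarrow> real"
    and g :: "real \<Rightarrow> real"
    and d \<beta> \<delta> :: real
    and s :: nat
    and N :: "nat set"
    and m l :: "nat \<Rightarrow> nat"
  assumes "prob_space M"
    and "s \<ge> 1"
    and "-1/2 < d" and "d < 1/2"
    and "I_process M d Y"
    and "\<beta> \<ge> 0"
    and "piecewise_continuous_01 g"
    and "\<exists>j\<in>{1..s}.
           integral {0..1} (\<lambda>x. of_real (g x) * exp (\<i> * of_real (2 * pi * real j * x))) \<noteq> (0::complex)"
    and "infinite N"
    and "\<And>n. n \<in> N \<Longrightarrow> n = m n * l n"
    and "filterlim m at_top (at_top_in N)"
    and "filterlim l at_top (at_top_in N)"
    and "\<delta> \<le> 1/2"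
  shows "tends_to_infinity_in_prob M
           (\<lambda>n \<omega>. Q_stat (\<lambda>t. trend \<beta> g n t + Y (int t) \<omega>) (m n) (l n) s \<delta>) (at_top_in N)"
  unfolding tends_to_infinity_in_prob_def
proof (intro allI impI)
  fix K :: real assume K: "K > 0"
  obtain a e where a: "I_coefficients d a" and e: "iid_noise M e"
    and Y: "\<And>t. Y t \<in> borel_measurable M"
    and sums: "\<And>t. AE \<omega> in M. (\<lambda>j. a j * e (t - int j) \<omega>) sums Y t \<omega>"
    using assms(5) unfolding I_process_def by blast
  have a2: "summable (\<lambda>j. (a j)\<^sup>2)" using a by (simp add: I_coefficients_def)
  obtain v where v: "white_noise M v e"
    using iid_noise_imp_white_noise[OF assms(1) e] .
  obtain S B where S: "finite S" "\<And>x. 0 \<le> x \<Longrightarrow> x \<le> 1 \<Longrightarrow> x \<notin> S \<Longrightarrow> isCont g x"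
    and B: "\<And>x. 0 \<le> x \<Longrightarrow> x \<le> 1 \<Longrightarrow> \<bar>g x\<bar> \<le> B"
    using piecewise_continuous_01_imp[OF assms(7)] by blast
  obtain j where j: "j \<in> {1..s}"
    "integral {0..1} (\<lambda>x. of_real (g x) * exp (\<i> * of_real (2 * pi * real j * x))) \<noteq> (0::complex)"
    using assms(8) by blast
  obtain u :: "nat \<Rightarrow> nat" where u: "\<And>k. u k \<in> N" "\<And>k. u k > 0" "at_top_in N = filtermap u sequentially"
    using at_top_in_enumeration[OF assms(9)] by blast
  have ml: "m (u k) * l (u k) = u k" for k using assms(10)[OF u(1)] by simp
  have pos: "m (u k) > 0" "l (u k) > 0" for k using ml[of k] u(2)[of k] by (auto intro: gr0I)
  have lim: "filterlim (\<lambda>k. m (u k)) at_top sequentially" "filterlim (\<lambda>k. l (u k)) at_top sequentially"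
    using assms(11,12) unfolding u(3) by (simp_all add: filterlim_filtermap)
  show "((\<lambda>n. measure M {\<omega> \<in> space M. ennreal K <
      Q_stat (\<lambda>t. trend \<beta> g n t + Y (int t) \<omega>) (m n) (l n) s \<delta>}) \<longlongrightarrow> 1) (at_top_in N)"
    unfolding u(3) filterlim_filtermap
    by (rule Q_stat_diverges_along_sequence[OF assms(1) v a2 Y sums assms(6,13) S B j pos(1) lim(1)
          pos(2) lim(2) K, unfolded ml])
qed

end
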